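(* Let (S) denote the Hamiltonian system $$\frac{dx}{dt}=\frac{\partial H}{\partial y},\quad \frac{dy}{dt}=-\frac{\partial H}{\partial x},\quad \frac{dz}{dt}=\frac{\partial H}{\partial w},\quad \frac{dw}{dt}=-\frac{\partial H}{\partial z}$$ with $$H=H_{VI}(x,y,t;\alpha_0,\alpha_1,\alpha_2,\alpha_3,\alpha_4)+H_{VI}(z,w,t;\beta_0,\beta_1,\beta_2,\beta_3,\beta_4)+\frac{2(x-t)yz\{(z-1)w+\beta_2\}}{t(t-1)}.$$ Then (S) has the following invariant divisors: if $\alpha_0=0$, $f_0:=x-t$; if $\alpha_1=0$, $f_1:=x-\infty$; if $\alpha_2=0$, $f_2:=y$; if $\alpha_4=\beta_4$, $f_3:=x-z$; if $\beta_2=0$, $f_4:=w$; if $\beta_3=0$, $f_5:=z-1$; if $\beta_4=0$, $f_6:=z$.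
   Context: For $\delta_0+\delta_1+2\delta_2+\delta_3+\delta_4=1$, $$H_{VI}(q,p,t;\delta_0,\dots,\delta_4)=\tfrac{1}{t(t-1)}\big[p^2(q-t)(q-1)q-\{(\delta_0-1)(q-1)q+\delta_3(q-t)q+\delta_4(q-t)(q-1)\}p+\delta_2(\delta_1+\delta_2)q\big].$$ The free parameters are complex numbers $\alpha_0,\alpha_1,\alpha_2,\alpha_4,\beta_2,\beta_3,\beta_4$ with $\alpha_0+\alpha_1+2\alpha_2+2(\alpha_4-\beta_4)+2\beta_2+\beta_3+\beta_4=1$; the other parameters are determined by $\alpha_3=\alpha_4-\beta_4+2\beta_2+\beta_3$, $\beta_0=\alpha_0+\alpha_4-\beta_4$, $\beta_1=\alpha_1+2\alpha_2+\alpha_4-\beta_4$. An invariant divisor $f$ means that the hypersurface $\{f=0\}$ is invariant under the (non-autonomous) flow of the system, i.e. the system admits the particular solutions $f=0$ (for example $y=0$ when $\alpha_2=0$; for $f_3$, one has $x_3=0$ after the birational symplectic change $x_3=x-z$, $y_3=y$, $z_3=z$, $w_3=w+y$). The divisor $x-\infty$ means the hypersurface $X=0$ in the coordinates $(X,Y,Z,W)=(1/x,-x(xy+\alpha_2),z,w)$. *)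

theory Defs
  imports "HOL-Analysis.Analysis"
begin

definition H_VI ::
  "complex \<Rightarrow> complex \<Rightarrow> complex \<Rightarrow> complex \<Rightarrow> complex \<Rightarrow> complex \<Rightarrow> complex \<Rightarrow> complex \<Rightarrow> complex"
where
  "H_VI q p t \<delta>\<^sub>0 \<delta>\<^sub>1 \<delta>\<^sub>2 \<delta>\<^sub>3 \<delta>\<^sub>4 =
     1 / (t * (t - 1)) *
       (p^2 * (q - t) * (q - 1) * q
        - ((\<delta>\<^sub>0 - 1) * (q - 1) * q + \<delta>\<^sub>3 * (q - t) * q + \<delta>\<^sub>4 * (q - t) * (q - 1)) * p
        + \<delta>\<^sub>2 * (\<delta>\<^sub>1 + \<delta>\<^sub>2) * q)"

text \<open>A point of the phase space is the vector with components \<open>x, y, z, w\<close> in this order.\<close>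

definition hamiltonian_field ::
  "(complex \<Rightarrow> complex \<Rightarrow> complex \<Rightarrow> complex \<Rightarrow> complex \<Rightarrow> complex) \<Rightarrow> complex \<Rightarrow> complex^4 \<Rightarrow> complex^4"
where
  "hamiltonian_field H t v =
     (let x = v $ 1; y = v $ 2; z = v $ 3; w = v $ 4 in
       vector [  deriv (\<lambda>y'. H x y' z w t) y,
               - deriv (\<lambda>x'. H x' y z w t) x,
                 deriv (\<lambda>w'. H x y z w' t) w,
               - deriv (\<lambda>z'. H x y z' w t) z])"

text \<open>The independent variable \<open>t\<close> is complex and avoids the fixed singularities \<open>0\<close> and \<open>1\<close>;
  solutions are single-valued holomorphic curves over a domain.\<close>

definition time_domain :: "complex set \<Rightarrow> bool" where
  "time_domain U \<longleftrightarrow> open U \<and> connected U \<and> U \<subseteq> - {0, 1}"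

definition solution_on ::
  "(complex \<Rightarrow> complex^4 \<Rightarrow> complex^4) \<Rightarrow> complex set \<Rightarrow> (complex \<Rightarrow> complex^4) \<Rightarrow> bool"
where
  "solution_on V U u \<longleftrightarrow>
     (\<forall>t\<in>U. \<forall>i. ((\<lambda>s. u s $ i) has_field_derivative V t (u t) $ i) (at t))"

text \<open>The first clause says that no solution leaves the (possibly time-dependent) hypersurface
  \<open>f = 0\<close>; the second one says that the system admits the particular solutions \<open>f = 0\<close>,
  through every point of the hypersurface and for every initial time.\<close>

definition invariant_divisor ::
  "(complex \<Rightarrow> complex^4 \<Rightarrow> complex^4) \<Rightarrow> (complex \<Rightarrow> complex^4 \<Rightarrow> complex) \<Rightarrow> bool"
where
  "invariant_divisor V f \<longleftrightarrow>
     (\<forall>U u. time_domain U \<longrightarrow> solution_on V U u \<longrightarrow>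
        (\<exists>t\<^sub>0\<in>U. f t\<^sub>0 (u t\<^sub>0) = 0) \<longrightarrow> (\<forall>t\<in>U. f t (u t) = 0)) \<and>
     (\<forall>t\<^sub>0 v. t\<^sub>0 \<notin> {0, 1} \<longrightarrow> f t\<^sub>0 v = 0 \<longrightarrow>
        (\<exists>U u. time_domain U \<and> t\<^sub>0 \<in> U \<and> solution_on V U u \<and> u t\<^sub>0 = v \<and>
               (\<forall>t\<in>U. f t (u t) = 0)))"

text \<open>\<open>V'\<close> is the vector field \<open>V\<close> written in the coordinates \<open>\<phi>\<close>, which are defined on \<open>D\<close>:
  it is the push-forward of \<open>V\<close> on the image of \<open>D\<close>, extended continuously to the whole new
  coordinate space. When the image of \<open>D\<close> is dense, \<open>V'\<close> is unique for times other than
  \<open>0\<close> and \<open>1\<close>.\<close>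

definition field_in_coordinates ::
  "(complex^4 \<Rightarrow> complex^4) \<Rightarrow> (complex^4) set \<Rightarrow> (complex \<Rightarrow> complex^4 \<Rightarrow> complex^4) \<Rightarrow>
   (complex \<Rightarrow> complex^4 \<Rightarrow> complex^4) \<Rightarrow> bool"
where
  "field_in_coordinates \<phi> D V V' \<longleftrightarrow>
     continuous_on ((- {0, 1}) \<times> UNIV) (\<lambda>(t, v). V' t v) \<and>
     (\<forall>t\<in>- {0, 1}. \<forall>v\<in>D.
        \<phi> differentiable (at v) \<and> V' t (\<phi> v) = frechet_derivative \<phi> (at v) (V t v))"

definition coords_at_infinity :: "complex \<Rightarrow> complex^4 \<Rightarrow> complex^4" where
  "coords_at_infinity \<alpha>\<^sub>2 v =
     (let x = v $ 1; y = v $ 2; z = v $ 3; w = v $ 4 in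
       vector [1 / x, - x * (x * y + \<alpha>\<^sub>2), z, w])"

text \<open>The divisor \<open>x - \<infinity>\<close>: it is not visible in the coordinates \<open>x, y, z, w\<close>.\<close>

definition invariant_divisor_x_infinity ::
  "complex \<Rightarrow> (complex \<Rightarrow> complex^4 \<Rightarrow> complex^4) \<Rightarrow> bool"
where
  "invariant_divisor_x_infinity \<alpha>\<^sub>2 V \<longleftrightarrow>
     (\<exists>V'. field_in_coordinates (coords_at_infinity \<alpha>\<^sub>2) {v. v $ 1 \<noteq> 0} V V' \<and>
           invariant_divisor V' (\<lambda>t v. v $ 1))"

end

theory Submission
  imports Defs "HOL-Complex_Analysis.Cauchy_Integral_Formula"
begin

text \<open>If \<open>f = 0\<close> is one of the listed hypersurfaces, then \<open>f\<close> divides its own derivative along the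
  flow: the derivative is \<open>f \<cdot> g\<close> with a cofactor \<open>g\<close> that is polynomial in the phase variables and
  holomorphic in \<open>t\<close>. Hence \<open>f\<close> satisfies a linear homogeneous equation along every solution, and it
  vanishes identically as soon as it vanishes once. The particular solutions through the points of
  the hypersurface come from the holomorphic Picard-Lindeloef theorem. For \<open>x = \<infinity>\<close> the same argument
  applies in the coordinates \<open>X, Y, Z, W\<close>, in which the system extends polynomially across \<open>X = 0\<close>.\<close>

section \<open>Functions polynomial in phase space with coefficients holomorphic in time\<close>

text \<open>The inductive form lets holomorphy along curves, joint continuity and Lipschitz bounds
  each follow by one rule induction, while membership of an explicit field follows from introduction
  rules. The clause \<open>time\<close> admits the factor \<open>1 / (t * (t - 1))\<close> when
  \<open>T\<close> is \<open>- {0, 1}\<close>.\<close>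

inductive holo_poly :: "complex set \<Rightarrow> (complex \<Rightarrow> complex^'n \<Rightarrow> complex) \<Rightarrow> bool"
  for T :: "complex set"
where
  time: "c holomorphic_on T \<Longrightarrow> holo_poly T (\<lambda>t v. c t)"
| coord: "holo_poly T (\<lambda>t v. v $ i)"
| add: "holo_poly T F \<Longrightarrow> holo_poly T G \<Longrightarrow> holo_poly T (\<lambda>t v. F t v + G t v)"
| mult: "holo_poly T F \<Longrightarrow> holo_poly T G \<Longrightarrow> holo_poly T (\<lambda>t v. F t v * G t v)"

lemma holo_poly_const: "holo_poly T (\<lambda>t v. c)"
  by (rule holo_poly.time) auto

lemma holo_poly_ident: "holo_poly T (\<lambda>t v. t)"
  by (rule holo_poly.time) auto

lemma holo_poly_uminus: "holo_poly T F \<Longrightarrow> holo_poly T (\<lambda>t v. - F t v)"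
  using holo_poly.mult[OF holo_poly_const[of T "-1"]] by fastforce

lemma holo_poly_diff:
  "holo_poly T F \<Longrightarrow> holo_poly T G \<Longrightarrow> holo_poly T (\<lambda>t v. F t v - G t v)"
  using holo_poly.add[OF _ holo_poly_uminus] by fastforce

lemma holo_poly_power: "holo_poly T F \<Longrightarrow> holo_poly T (\<lambda>t v. F t v ^ n)"
  by (induction n) (auto intro: holo_poly.mult holo_poly_const)

lemmas holo_poly_intros = holo_poly_const holo_poly_ident holo_poly.coord holo_poly.add
  holo_poly.mult holo_poly_uminus holo_poly_diff holo_poly_power

lemma holo_poly_along_curve:
  assumes "holo_poly T F" "U \<subseteq> T" "\<And>i. (\<lambda>s. u s $ i) holomorphic_on U"
  shows "(\<lambda>s. F s (u s)) holomorphic_on U"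
  using assms(1)
  by induction (auto intro!: holomorphic_intros assms(3) intro: holomorphic_on_subset[OF _ assms(2)])

lemma holo_poly_continuous:
  assumes "holo_poly T F"
  shows "continuous_on (T \<times> UNIV) (\<lambda>(t, v). F t v)"
  using assms
proof induction
  case (time c)
  then have "continuous_on T c"
    by (rule holomorphic_on_imp_continuous_on)
  then show ?case
    by (auto simp: case_prod_beta intro!: continuous_intros intro: continuous_on_compose2)
next
  case (coord i)
  then show ?case by (auto simp: case_prod_beta intro!: continuous_intros)
next
  case (add F G)
  then show ?case by (auto simp: case_prod_beta intro!: continuous_intros)
next
  case (mult F G)
  then show ?case by (auto simp: case_prod_beta intro!: continuous_intros)
qed

section \<open>Bounds and Lipschitz estimates on compact sets\<close>

text \<open>Both estimates share one constant because the Lipschitz estimate of a product needs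
  bounds on its factors. Distances are measured by an upper bound \<open>e\<close> for all
  coordinate differences, the form in which the Picard iteration supplies them.\<close>

definition bounded_lipschitz ::
  "complex set \<Rightarrow> real \<Rightarrow> real \<Rightarrow> (complex \<Rightarrow> complex^'n \<Rightarrow> complex) \<Rightarrow> bool"
where
  "bounded_lipschitz K R L F \<longleftrightarrow>
     (\<forall>t\<in>K. \<forall>v w. (\<forall>j. norm (v $ j) \<le> R) \<longrightarrow> (\<forall>j. norm (w $ j) \<le> R) \<longrightarrow>
        norm (F t v) \<le> L \<and>
        (\<forall>e. (\<forall>j. norm (v $ j - w $ j) \<le> e) \<longrightarrow> norm (F t v - F t w) \<le> L * e))"

lemma bounded_lipschitzI:
  assumes "\<And>t v. t \<in> K \<Longrightarrow> (\<And>j. norm (v $ j) \<le> R) \<Longrightarrow> norm (F t v) \<le> L"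
    and "\<And>t v w e. t \<in> K \<Longrightarrow> (\<And>j. norm (v $ j) \<le> R) \<Longrightarrow> (\<And>j. norm (w $ j) \<le> R) \<Longrightarrow>
      (\<And>j. norm (v $ j - w $ j) \<le> e) \<Longrightarrow> 0 \<le> e \<Longrightarrow> norm (F t v - F t w) \<le> L * e"
  shows "bounded_lipschitz K R L F"
  unfolding bounded_lipschitz_def
proof (intro ballI allI impI conjI)
  fix t and v w :: "complex^'a" and e
  assume *: "t \<in> K" "\<forall>j. norm (v $ j) \<le> R" "\<forall>j. norm (w $ j) \<le> R"
  then show "norm (F t v) \<le> L"
    using assms(1) by blast
  assume e: "\<forall>j. norm (v $ j - w $ j) \<le> e"
  \<comment> \<open>The index type is nonempty, so \<open>e\<close> bounds at least one
    norm.\<close>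
  then have "0 \<le> e"
    using norm_ge_zero order_trans by blast
  then show "norm (F t v - F t w) \<le> L * e"
    using assms(2) * e by blast
qed

lemma bounded_lipschitzD:
  assumes "bounded_lipschitz K R L F" "t \<in> K" "\<And>j. norm (v $ j) \<le> R"
  shows "norm (F t v) \<le> L"
    and "(\<And>j. norm (w $ j) \<le> R) \<Longrightarrow> (\<And>j. norm (v $ j - w $ j) \<le> e) \<Longrightarrow>
      norm (F t v - F t w) \<le> L * e"
  using assms unfolding bounded_lipschitz_def by blast+

text \<open>Coefficients are bounded on the compact set \<open>K\<close> by continuity, and the two
  estimates pass through sums and products.\<close>

lemma holo_poly_bounded_lipschitz:
  assumes "holo_poly T F" "compact K" "K \<subseteq> T"
  shows "\<exists>L\<ge>0. bounded_lipschitz K R L F"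
  using assms(1)
proof induction
  case (time c)
  have "compact (c ` K)"
    using assms time
    by (meson compact_continuous_image continuous_on_subset holomorphic_on_imp_continuous_on)
  then obtain L where L: "\<And>t. t \<in> K \<Longrightarrow> norm (c t) \<le> L"
    using compact_imp_bounded bounded_iff by (metis imageI)
  \<comment> \<open>The absolute value guards against a negative \<open>L\<close>, which is possible
    when \<open>K\<close> is empty.\<close>
  have "bounded_lipschitz K R \<bar>L\<bar> (\<lambda>t v :: complex^'a. c t)"
    by (rule bounded_lipschitzI) (use L in fastforce)+
  then show ?case
    using abs_ge_zero by blast
next
  case (coord i)
  \<comment> \<open>The constant must be at least \<open>R\<close> for the bound and at least 1 for
    the Lipschitz estimate.\<close>
  have "bounded_lipschitz K R (\<bar>R\<bar> + 1) (\<lambda>t v. v $ i)"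
  proof (rule bounded_lipschitzI)
    fix t and v w :: "complex^'a" and e :: real
    show "norm (v $ i) \<le> \<bar>R\<bar> + 1" if "\<And>j. norm (v $ j) \<le> R"
      using that[of i] by linarith
    assume e: "\<And>j. norm (v $ j - w $ j) \<le> e" "0 \<le> e"
    then have "e \<le> (\<bar>R\<bar> + 1) * e"
      by (simp add: algebra_simps)
    with e(1)[of i] show "norm (v $ i - w $ i) \<le> (\<bar>R\<bar> + 1) * e"
      by linarith
  qed
  then show ?case
    by (metis abs_ge_zero add_nonneg_nonneg zero_le_one)
next
  case (add F G)
  then obtain L M where LM: "L \<ge> 0" "M \<ge> 0"
      "bounded_lipschitz K R L F" "bounded_lipschitz K R M G"
    by blast
  have "bounded_lipschitz K R (L + M) (\<lambda>t v. F t v + G t v)"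
  proof (rule bounded_lipschitzI)
    fix t and v w :: "complex^'a" and e
    assume *: "t \<in> K" "\<And>j. norm (v $ j) \<le> R"
    show "norm (F t v + G t v) \<le> L + M"
      using bounded_lipschitzD(1)[OF LM(3) *] bounded_lipschitzD(1)[OF LM(4) *]
      by (rule norm_triangle_le[OF add_mono])
    assume **: "\<And>j. norm (w $ j) \<le> R" "\<And>j. norm (v $ j - w $ j) \<le> e"
    have "norm ((F t v - F t w) + (G t v - G t w)) \<le> L * e + M * e"
      using bounded_lipschitzD(2)[OF LM(3) * **] bounded_lipschitzD(2)[OF LM(4) * **]
      by (rule norm_triangle_le[OF add_mono])
    then show "norm (F t v + G t v - (F t w + G t w)) \<le> (L + M) * e"
      by (simp add: algebra_simps)
  qed
  with LM show ?case
    by (metis add_nonneg_nonneg)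
next
  case (mult F G)
  then obtain L M where LM: "L \<ge> 0" "M \<ge> 0"
      "bounded_lipschitz K R L F" "bounded_lipschitz K R M G"
    by blast
  \<comment> \<open>The difference of products splits as
    \<open>F t v * (G t v - G t w) + (F t v - F t w) * G t w\<close>, and each summand contributes
    \<open>L * M * e\<close>.\<close>
  have "bounded_lipschitz K R (2 * (L * M)) (\<lambda>t v. F t v * G t v)"
  proof (rule bounded_lipschitzI)
    fix t and v w :: "complex^'a" and e
    assume *: "t \<in> K" "\<And>j. norm (v $ j) \<le> R"
    note bd = bounded_lipschitzD(1)[OF LM(3) *] bounded_lipschitzD(1)[OF LM(4) *]
    have "norm (F t v * G t v) \<le> L * M"
      unfolding norm_mult using bd \<open>L \<ge> 0\<close> by (intro mult_mono) auto
    moreover have "0 \<le> L * M"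
      using \<open>L \<ge> 0\<close> \<open>M \<ge> 0\<close> by simp
    ultimately show "norm (F t v * G t v) \<le> 2 * (L * M)"
      by linarith
    assume **: "\<And>j. norm (w $ j) \<le> R" "\<And>j. norm (v $ j - w $ j) \<le> e" and "0 \<le> e"
    note lip = bounded_lipschitzD(2)[OF LM(3) * **] bounded_lipschitzD(2)[OF LM(4) * **]
    have "norm (F t v * (G t v - G t w)) \<le> L * (M * e)"
      unfolding norm_mult using bd lip \<open>L \<ge> 0\<close> by (intro mult_mono) auto
    moreover have "norm ((F t v - F t w) * G t w) \<le> (L * e) * M"
      unfolding norm_mult using lip bounded_lipschitzD(1)[OF LM(4) *(1) **(1)] \<open>L \<ge> 0\<close> \<open>0 \<le> e\<close>
      by (intro mult_mono) auto
    ultimately have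
      "norm (F t v * (G t v - G t w) + (F t v - F t w) * G t w) \<le> L * (M * e) + (L * e) * M"
      by (rule norm_triangle_le[OF add_mono])
    then show "norm (F t v * G t v - F t w * G t w) \<le> 2 * (L * M) * e"
      by (simp add: algebra_simps)
  qed
  with LM show ?case
    by (metis mult_nonneg_nonneg zero_le_numeral)
qed

lemma bounded_lipschitz_mono:
  assumes "bounded_lipschitz K R L F" "L \<le> M"
  shows "bounded_lipschitz K R M F"
proof (rule bounded_lipschitzI)
  fix t and v w :: "complex^'a" and e
  assume *: "t \<in> K" "\<And>j. norm (v $ j) \<le> R"
  show "norm (F t v) \<le> M"
    using bounded_lipschitzD(1)[OF assms(1) *] assms(2) by linarith
  assume **: "\<And>j. norm (w $ j) \<le> R" "\<And>j. norm (v $ j - w $ j) \<le> e" and "0 \<le> e"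
  then have "L * e \<le> M * e"
    using assms(2) by (simp add: mult_right_mono)
  with bounded_lipschitzD(2)[OF assms(1) * **(1,2)] show "norm (F t v - F t w) \<le> M * e"
    by linarith
qed

text \<open>There are finitely many components, so the sum of their nonnegative constants dominates
  each of them; adding 1 makes the common constant positive, so that one can divide by it.\<close>

lemma holo_poly_uniformly_bounded_lipschitz:
  fixes V :: "complex \<Rightarrow> complex^'n \<Rightarrow> complex^'n"
  assumes "\<And>i. holo_poly T (\<lambda>t v. V t v $ i)" "compact K" "K \<subseteq> T"
  obtains L where "L > 0" "\<And>i. bounded_lipschitz K R L (\<lambda>t v. V t v $ i)"
proof -
  obtain L where L0: "\<And>i. L i \<ge> 0" and
    L: "\<And>i. bounded_lipschitz K R (L i) (\<lambda>t v. V t v $ i)"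
    using holo_poly_bounded_lipschitz[OF assms(1) assms(2,3), of R] by metis
  have "L i \<le> sum L UNIV + 1" for i
    using member_le_sum[of i UNIV L] L0 by simp
  moreover have "sum L UNIV + 1 > 0"
    using sum_nonneg[of UNIV L] L0 by (simp add: add_nonneg_pos)
  ultimately show ?thesis
    using that bounded_lipschitz_mono[OF L] by blast
qed

section \<open>The holomorphic Picard-Lindeloef theorem\<close>

text \<open>Picard iteration with complex primitives in place of integrals: on a small ball the
  iterates stay in a fixed polydisc and their successive differences halve, so they converge
  uniformly, and the derivatives converge to the derivative of the limit.\<close>

lemma holomorphic_picard_lindelof:
  fixes V :: "complex \<Rightarrow> complex^'n \<Rightarrow> complex^'n"
  assumes V: "\<And>i. holo_poly T (\<lambda>t v. V t v $ i)" and "open T" "t\<^sub>0 \<in> T"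
  shows "\<exists>r>0. \<exists>u. ball t\<^sub>0 r \<subseteq> T \<and> u t\<^sub>0 = v\<^sub>0 \<and>
    (\<forall>t\<in>ball t\<^sub>0 r. \<forall>i. ((\<lambda>s. u s $ i) has_field_derivative V t (u t) $ i) (at t))"
proof -
  obtain r\<^sub>0 where r0: "r\<^sub>0 > 0" "cball t\<^sub>0 r\<^sub>0 \<subseteq> T"
    using assms(2,3) open_contains_cball by blast
  \<comment> \<open>All iterates stay within distance 1 of \<open>v\<^sub>0\<close> in each
    coordinate, so \<open>R\<close> bounds their coordinates.\<close>
  define R where "R = norm v\<^sub>0 + 1"
  obtain L where "L > 0" and lip: "\<And>i. bounded_lipschitz (cball t\<^sub>0 r\<^sub>0) R L (\<lambda>t v. V t v $ i)"
    using holo_poly_uniformly_bounded_lipschitz[OF V compact_cball r0(2), of R] by blast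
  \<comment> \<open>The radius is chosen so that \<open>L * r \<le> 1 / 2\<close>, which yields both
    the confinement of the iterates and the contraction.\<close>
  define r where "r = min r\<^sub>0 (1 / (2 * L))"
  have "r > 0" "r \<le> r\<^sub>0" "L * r \<le> 1 / 2"
    using \<open>L > 0\<close> r0 by (auto simp: r_def min_def field_simps)
  define B where "B = ball t\<^sub>0 r"
  have BK: "B \<subseteq> cball t\<^sub>0 r\<^sub>0"
    using \<open>r \<le> r\<^sub>0\<close> by (auto simp: B_def)
  then have BT: "B \<subseteq> T"
    using r0 by blast
  have B: "open B" "convex B" "t\<^sub>0 \<in> B"
    using \<open>r > 0\<close> by (auto simp: B_def)
  \<comment> \<open>Mean value inequality on the convex ball. It is used with \<open>e = 1\<close>
    to keep an iterate near \<open>v\<^sub>0\<close>, and with \<open>e\<close> a bound for the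
    previous difference of iterates to halve that bound.\<close>
  have increment: "norm (f t - f t\<^sub>0) \<le> e / 2"
    if "\<And>t. t \<in> B \<Longrightarrow> (f has_field_derivative f' t) (at t)"
      "\<And>t. t \<in> B \<Longrightarrow> norm (f' t) \<le> L * e" "t \<in> B" for f f' t and e :: real
  proof -
    have "0 \<le> L * e"
      using that norm_ge_zero order_trans by blast
    then have "e \<ge> 0"
      using \<open>L > 0\<close> by (simp add: zero_le_mult_iff)
    have "norm (f t - f t\<^sub>0) \<le> L * e * norm (t - t\<^sub>0)"
      by (rule field_differentiable_bound[OF B(2)])
        (use that B in \<open>auto intro: has_field_derivative_at_within\<close>)
    also have "\<dots> \<le> L * e * r"
      using that(3) \<open>0 \<le> L * e\<close> by (intro mult_left_mono) (auto simp: B_def dist_norm norm_minus_commute)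
    also have "\<dots> = (L * r) * e" by simp
    also have "\<dots> \<le> 1 / 2 * e"
      using \<open>L * r \<le> 1 / 2\<close> \<open>e \<ge> 0\<close> by (rule mult_right_mono)
    finally show ?thesis by simp
  qed
  \<comment> \<open>The invariant of the iteration: holomorphic, confined to the polydisc of radius
    1 about \<open>v\<^sub>0\<close>, with the right initial value.\<close>
  define Q where "Q u \<longleftrightarrow> (\<forall>i. (\<lambda>s. u s $ i) holomorphic_on B) \<and>
    (\<forall>s\<in>B. \<forall>i. norm (u s $ i - v\<^sub>0 $ i) \<le> 1) \<and> u t\<^sub>0 = v\<^sub>0" for u :: "complex \<Rightarrow> complex^'n"
  have QR: "norm (u s $ i) \<le> R" if "Q u" "s \<in> B" for u s i
  proof -
    have "norm (u s $ i - v\<^sub>0 $ i) \<le> 1" 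
      using that by (auto simp: Q_def)
    moreover have "norm (v\<^sub>0 $ i) \<le> norm v\<^sub>0"
      by (rule Finite_Cartesian_Product.norm_nth_le)
    ultimately show ?thesis
      unfolding R_def using norm_triangle_sub[of "u s $ i" "v\<^sub>0 $ i"] by linarith
  qed
  \<comment> \<open>Along \<open>u\<close> the field is holomorphic on the convex open set
    \<open>B\<close>, so each component has a primitive there; normalised at
    \<open>t\<^sub>0\<close>, these primitives form the next iterate.\<close>
  have step: "\<exists>u'. Q u' \<and>
      (\<forall>t\<in>B. \<forall>i. ((\<lambda>s. u' s $ i) has_field_derivative V t (u t) $ i) (at t))" if "Q u" for u
  proof -
    have "\<forall>i. \<exists>g. \<forall>t\<in>B. (g has_field_derivative V t (u t) $ i) (at t)"
    proof
      fix i
      have "(\<lambda>s. V s (u s) $ i) holomorphic_on B"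
        using holo_poly_along_curve[OF V BT] \<open>Q u\<close> by (auto simp: Q_def)
      then obtain g where "\<And>t. t \<in> B \<Longrightarrow> (g has_field_derivative V t (u t) $ i) (at t within B)"
        using holomorphic_convex_primitive'[OF B(2,1)] by blast
      then show "\<exists>g. \<forall>t\<in>B. (g has_field_derivative V t (u t) $ i) (at t)"
        using B(1) by (auto simp: at_within_open[of _ B] intro!: exI[of _ g])
    qed
    then obtain g where g: "\<And>i t. t \<in> B \<Longrightarrow> (g i has_field_derivative V t (u t) $ i) (at t)"
      by metis
    define u' where "u' s = (\<chi> i. v\<^sub>0 $ i + (g i s - g i t\<^sub>0))" for s
    have der: "((\<lambda>s. u' s $ i) has_field_derivative V t (u t) $ i) (at t)" if "t \<in> B" for i t
      unfolding u'_def using that by (auto intro!: derivative_eq_intros g)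
    have u't0: "u' t\<^sub>0 = v\<^sub>0"
      by (simp add: u'_def)
    have "(\<lambda>s. u' s $ i) holomorphic_on B" for i
      using der B(1) holomorphic_on_open by blast
    moreover have "norm (u' s $ i - v\<^sub>0 $ i) \<le> 1" if "s \<in> B" for s i
    proof -
      have "norm (u' s $ i - u' t\<^sub>0 $ i) \<le> 1 / 2"
      proof (rule increment[OF der _ that])
        fix t assume "t \<in> B"
        then show "norm (V t (u t) $ i) \<le> L * 1"
          using bounded_lipschitzD(1)[OF lip] QR[OF \<open>Q u\<close>] BK by (simp add: subset_iff)
      qed
      then show ?thesis by (simp add: u't0)
    qed
    ultimately show ?thesis
      using der u't0 unfolding Q_def by blast
  qed
  \<comment> \<open>The step only asserts existence of a next iterate, so the sequence comes from
    dependent choice, starting at the constant curve \<open>v\<^sub>0\<close>.\<close>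
  have "\<exists>u. \<forall>n. Q (u n) \<and>
      (\<forall>t\<in>B. \<forall>i. ((\<lambda>s. u (Suc n) s $ i) has_field_derivative V t (u n t) $ i) (at t))"
  proof (rule dependent_nat_choice)
    show "\<exists>u. Q u"
      by (rule exI[of _ "\<lambda>_. v\<^sub>0"]) (simp add: Q_def)
  qed (use step in blast)
  then obtain u where Qu: "\<And>n. Q (u n)" and
    du: "\<And>n t i. t \<in> B \<Longrightarrow> ((\<lambda>s. u (Suc n) s $ i) has_field_derivative V t (u n t) $ i) (at t)"
    by blast
  have u0: "u n t\<^sub>0 = v\<^sub>0" for n
    using Qu by (simp add: Q_def)
  \<comment> \<open>The first difference is at most \<open>2 * R\<close> because both iterates are
    bounded by \<open>R\<close>. Later differences vanish at \<open>t\<^sub>0\<close>, and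
    \<open>increment\<close> halves the bound each time.\<close>
  have contraction: "norm (u (Suc n) t $ i - u n t $ i) \<le> 2 * R * (1 / 2) ^ n" if "t \<in> B" for n t i
    using that
  proof (induction n arbitrary: t i)
    case 0
    have "norm (u 1 t $ i) \<le> R" "norm (u 0 t $ i) \<le> R"
      using QR[OF Qu 0] by auto
    then show ?case
      using norm_triangle_ineq4[of "u 1 t $ i" "u 0 t $ i"] by simp
  next
    case (Suc n)
    let ?d = "\<lambda>s. u (Suc (Suc n)) s $ i - u (Suc n) s $ i"
    have "norm (?d t - ?d t\<^sub>0) \<le> 2 * R * (1 / 2) ^ n / 2"
    proof (rule increment[OF _ _ \<open>t \<in> B\<close>])
      fix s assume "s \<in> B"
      then show "(?d has_field_derivative V s (u (Suc n) s) $ i - V s (u n s) $ i) (at s)"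
        by (intro DERIV_diff du)
      show "norm (V s (u (Suc n) s) $ i - V s (u n s) $ i) \<le> L * (2 * R * (1 / 2) ^ n)"
        using \<open>s \<in> B\<close> BK by (intro bounded_lipschitzD(2)[OF lip] QR[OF Qu] Suc.IH) auto
    qed
    then show ?case
      by (simp add: u0)
  qed
  \<comment> \<open>The limit is written as a telescoping series so that the Weierstrass M-test
    gives uniform convergence.\<close>
  define U where "U t = (\<chi> i. (\<Sum>n. u (Suc n) t $ i - u n t $ i) + u 0 t $ i)" for t
  have lim: "uniform_limit B (\<lambda>n t. u n t $ i) (\<lambda>t. U t $ i) sequentially" for i
  proof -
    have "summable (\<lambda>n. 2 * R * (1 / 2) ^ n)"
      by (intro summable_mult summable_geometric) simp
    then have "uniform_limit B (\<lambda>n t. \<Sum>k<n. u (Suc k) t $ i - u k t $ i)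
        (\<lambda>t. \<Sum>n. u (Suc n) t $ i - u n t $ i) sequentially"
      using contraction by (intro Weierstrass_m_test) auto
    then have "uniform_limit B (\<lambda>n t. (\<Sum>k<n. u (Suc k) t $ i - u k t $ i) + u 0 t $ i)
        (\<lambda>t. (\<Sum>n. u (Suc n) t $ i - u n t $ i) + u 0 t $ i) sequentially"
      by (intro uniform_limit_intros)
    moreover have "(\<Sum>k<n. u (Suc k) t $ i - u k t $ i) + u 0 t $ i = u n t $ i" for n t
      using sum_lessThan_telescope[of "\<lambda>k. u k t $ i" n] by simp
    ultimately show ?thesis
      by (simp add: U_def)
  qed
  have limp: "(\<lambda>n. u n t $ i) \<longlonglongrightarrow> U t $ i" if "t \<in> B" for t i
    using tendsto_uniform_limitI[OF lim that] .
  have "((\<lambda>s. U s $ i) has_field_derivative V t (U t) $ i) (at t)" if "t \<in> B" for t i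
  proof -
    \<comment> \<open>Derivatives converge along with a locally uniformly convergent holomorphic
      sequence. The sequence is shifted to \<open>u (Suc n)\<close>, whose derivative is the field
      at \<open>u n\<close>; continuity of the field then identifies the limit as its value at
      \<open>U t\<close>.\<close>
    have "\<exists>g'. \<forall>t\<in>B. ((\<lambda>s. U s $ i) has_field_derivative g' t) (at t) \<and>
        (\<lambda>n. V t (u n t) $ i) \<longlonglongrightarrow> g' t"
    proof (rule has_complex_derivative_uniform_sequence[OF B(1)])
      fix t assume "t \<in> B"
      then obtain d where "d > 0" "cball t d \<subseteq> B"
        using B(1) open_contains_cball by blast
      moreover have "uniform_limit B (\<lambda>n t. u (Suc n) t $ i) (\<lambda>t. U t $ i) sequentially"
        using lim[of i] by (simp add: filterlim_sequentially_Suc[of "\<lambda>n t. u n t $ i"])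
      ultimately show "\<exists>d>0. cball t d \<subseteq> B \<and>
          uniform_limit (cball t d) (\<lambda>n t. u (Suc n) t $ i) (\<lambda>t. U t $ i) sequentially"
        using uniform_limit_on_subset by blast
    qed (use du in blast)
    then obtain D where D: "((\<lambda>s. U s $ i) has_field_derivative D) (at t)"
        "(\<lambda>n. V t (u n t) $ i) \<longlonglongrightarrow> D"
      using \<open>t \<in> B\<close> by blast
    have "continuous_on UNIV (Pair t :: complex^'n \<Rightarrow> _)"
      using continuous_on_Pair[OF continuous_on_const[of _ t] continuous_on_id] by simp
    then have "continuous_on UNIV (\<lambda>v. V t v $ i)"
      using continuous_on_compose2[OF holo_poly_continuous[OF V[of i]], of UNIV "Pair t"]
        \<open>t \<in> B\<close> BT by auto
    moreover have "(\<lambda>n. u n t) \<longlonglongrightarrow> U t"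
      by (rule vec_tendstoI) (rule limp[OF that])
    ultimately have "(\<lambda>n. V t (u n t) $ i) \<longlonglongrightarrow> V t (U t) $ i"
      by (rule continuous_on_tendsto_compose) auto
    with D show ?thesis
      using LIMSEQ_unique by blast
  qed
  moreover have "U t\<^sub>0 = v\<^sub>0"
    using limp[OF B(3)] by (simp add: vec_eq_iff u0 LIMSEQ_const_iff)
  ultimately show ?thesis
    using \<open>r > 0\<close> BT unfolding B_def by blast
qed

section \<open>Propagation of zeros and the cofactor criterion\<close>

text \<open>The zero set of \<open>h\<close> is relatively closed by continuity. It is open because
  near a zero the integrating factor \<open>exp (- G x)\<close>, with \<open>G\<close> a local
  primitive of \<open>g\<close>, turns \<open>h\<close> into a constant, which must be 0.
  Connectedness does the rest.\<close>

lemma linear_ode_zero_propagates: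
  fixes h g :: "complex \<Rightarrow> complex"
  assumes U: "open U" "connected U" and g: "g holomorphic_on U"
    and h: "\<And>t. t \<in> U \<Longrightarrow> (h has_field_derivative h t * g t) (at t)"
    and "t\<^sub>0 \<in> U" "h t\<^sub>0 = 0" "t \<in> U"
  shows "h t = 0"
proof -
  have "open {t \<in> U. h t = 0}"
    unfolding open_contains_ball
  proof
    fix a assume "a \<in> {t \<in> U. h t = 0}"
    then have a: "a \<in> U" "h a = 0" by auto
    then obtain r where r: "r > 0" "ball a r \<subseteq> U"
      using U(1) open_contains_ball by blast
    obtain G where "\<And>x. x \<in> ball a r \<Longrightarrow> (G has_field_derivative g x) (at x within ball a r)"
      using holomorphic_convex_primitive'[of "ball a r" g] holomorphic_on_subset[OF g r(2)]
      by auto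
    then have G: "\<And>x. x \<in> ball a r \<Longrightarrow> (G has_field_derivative g x) (at x)"
      by (simp add: at_within_open[of _ "ball a r"])
    have "\<exists>c. \<forall>x\<in>ball a r. h x * exp (- G x) = c"
    proof (rule has_field_derivative_zero_constant)
      fix x assume x: "x \<in> ball a r"
      have "((\<lambda>x. h x * exp (- G x)) has_field_derivative 0) (at x)"
        using x r(2) by (auto intro!: derivative_eq_intros h G simp: algebra_simps)
      then show "((\<lambda>x. h x * exp (- G x)) has_field_derivative 0) (at x within ball a r)"
        by (rule has_field_derivative_at_within)
    qed auto
    then obtain c where c: "\<And>x. x \<in> ball a r \<Longrightarrow> h x * exp (- G x) = c"
      by blast
    moreover have "c = 0"
      using c[of a] a(2) r(1) by simp
    ultimately have "h x = 0" if "x \<in> ball a r" for x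
      using that by fastforce
    with r show "\<exists>e>0. ball a e \<subseteq> {t \<in> U. h t = 0}"
      by blast
  qed
  moreover have "continuous_on U h"
    using h by (meson DERIV_isCont continuous_at_imp_continuous_on)
  ultimately show ?thesis
    using continuous_levelset_open[OF U(2), of h 0] assms(5-7) by blast
qed



text \<open>Along a solution \<open>f\<close> satisfies a linear homogeneous equation with
  holomorphic coefficient, so a single zero forces it to vanish throughout. A local solution through
  a given point of the hypersurface exists by Picard-Lindeloef, and the first part keeps it there.
  The derivative of \<open>f\<close> is taken along solutions, which covers divisors depending on
  \<open>t\<close>.\<close>

lemma invariant_divisor_if_cofactor:
  assumes V: "\<And>i. holo_poly (- {0, 1}) (\<lambda>t v. V t v $ i)"
    and g: "holo_poly (- {0, 1}) g"
    and f: "\<And>U u t. solution_on V U u \<Longrightarrow> t \<in> U \<Longrightarrow> t \<notin> {0, 1} \<Longrightarrow>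
      ((\<lambda>s. f s (u s)) has_field_derivative f t (u t) * g t (u t)) (at t)"
  shows "invariant_divisor V f"
proof -
  have zero: "\<forall>t\<in>U. f t (u t) = 0"
    if U: "time_domain U" and u: "solution_on V U u" and t\<^sub>0: "t\<^sub>0 \<in> U" "f t\<^sub>0 (u t\<^sub>0) = 0"
    for U u t\<^sub>0
  proof
    fix t assume "t \<in> U"
    have U': "open U" "connected U" "U \<subseteq> - {0, 1}"
      using U by (auto simp: time_domain_def)
    have "(\<lambda>s. u s $ i) holomorphic_on U" for i
      using u U'(1) by (auto simp: solution_on_def holomorphic_on_open)
    then have "(\<lambda>s. g s (u s)) holomorphic_on U"
      by (rule holo_poly_along_curve[OF g U'(3)])
    moreover have "((\<lambda>s. f s (u s)) has_field_derivative f s (u s) * g s (u s)) (at s)"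
      if "s \<in> U" for s
      using f[OF u that] U'(3) that by blast
    ultimately show "f t (u t) = 0"
      using linear_ode_zero_propagates[where h = "\<lambda>s. f s (u s)", OF U'(1,2) _ _ t\<^sub>0 \<open>t \<in> U\<close>]
      by blast
  qed
  have "\<exists>U u. time_domain U \<and> t\<^sub>0 \<in> U \<and> solution_on V U u \<and> u t\<^sub>0 = v \<and> (\<forall>t\<in>U. f t (u t) = 0)"
    if "t\<^sub>0 \<notin> {0, 1}" "f t\<^sub>0 v = 0" for t\<^sub>0 v
  proof -
    have "open (- {0, 1 :: complex})"
      by (intro open_Compl finite_imp_closed) auto
    moreover have "t\<^sub>0 \<in> - {0, 1}"
      using that(1) by simp
    ultimately obtain r u where "r > 0" "ball t\<^sub>0 r \<subseteq> - {0, 1}" "u t\<^sub>0 = v" and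
      "\<And>t i. t \<in> ball t\<^sub>0 r \<Longrightarrow> ((\<lambda>s. u s $ i) has_field_derivative V t (u t) $ i) (at t)"
      using holomorphic_picard_lindelof[OF V, of t\<^sub>0 v] by blast
    then have "time_domain (ball t\<^sub>0 r)" "t\<^sub>0 \<in> ball t\<^sub>0 r" "solution_on V (ball t\<^sub>0 r) u"
      by (auto simp: time_domain_def solution_on_def)
    with zero[of "ball t\<^sub>0 r" u t\<^sub>0] that(2) \<open>u t\<^sub>0 = v\<close> show ?thesis
      by blast
  qed
  with zero show ?thesis
    unfolding invariant_divisor_def by blast
qed

section \<open>The Hamiltonian field in explicit polynomial form\<close>

lemma solution_on_component:
  "solution_on V U u \<Longrightarrow> t \<in> U \<Longrightarrow>
   ((\<lambda>s. u s $ i) has_field_derivative V t (u t) $ i) (at t)"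
  by (simp add: solution_on_def)

lemma holo_poly_time_factor: "holo_poly (- {0, 1}) (\<lambda>t v. 1 / (t * (t - 1)))"
  by (rule holo_poly.time) (auto intro!: holomorphic_intros)

lemma vector_4 [simp]:
  "(vector [a, b, c, d] :: ('a::zero)^4) $ 1 = a"
  "(vector [a, b, c, d] :: ('a::zero)^4) $ 2 = b"
  "(vector [a, b, c, d] :: ('a::zero)^4) $ 3 = c"
  "(vector [a, b, c, d] :: ('a::zero)^4) $ 4 = d"
  unfolding vector_def by simp_all

text \<open>Linearity and the limit of the difference quotient can both be checked coordinatewise; a
  linear map on a finite-dimensional space is bounded.\<close>

lemma has_derivative_vecI:
  fixes f :: "'a::euclidean_space \<Rightarrow> 'b::euclidean_space^'n"
  assumes "\<And>i. ((\<lambda>v. f v $ i) has_derivative (\<lambda>h. f' h $ i)) F"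
  shows "(f has_derivative f') F"
  unfolding has_derivative_def
proof
  have "linear (\<lambda>h. f' h $ i)" for i
    using assms has_derivative_linear by blast
  then have "linear f'"
    by (simp add: linear_iff vec_eq_iff)
  then show "bounded_linear f'"
    by (simp add: linear_conv_bounded_linear)
  show "((\<lambda>y. ((f y - f (Lim F (\<lambda>x. x))) - f' (y - Lim F (\<lambda>x. x)))
      /\<^sub>R norm (y - Lim F (\<lambda>x. x))) \<longlongrightarrow> 0) F"
    by (rule vec_tendstoI) (use assms in \<open>simp add: has_derivative_def\<close>)
qed

text \<open>Replacing \<open>deriv\<close> by explicit polynomials times
  \<open>1 / (t * (t - 1))\<close> turns every later divisibility claim into a polynomial identity.
  As division by zero gives 0, the formulas hold for every \<open>t\<close>.\<close>

lemma coupled_field_components: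
  fixes \<alpha>\<^sub>0 \<alpha>\<^sub>1 \<alpha>\<^sub>2 \<alpha>\<^sub>3 \<alpha>\<^sub>4 \<beta>\<^sub>0 \<beta>\<^sub>1 \<beta>\<^sub>2 \<beta>\<^sub>3 \<beta>\<^sub>4 t :: complex and v :: "complex^4"
  defines "H \<equiv> (\<lambda>x y z w t.
           H_VI x y t \<alpha>\<^sub>0 \<alpha>\<^sub>1 \<alpha>\<^sub>2 \<alpha>\<^sub>3 \<alpha>\<^sub>4 + H_VI z w t \<beta>\<^sub>0 \<beta>\<^sub>1 \<beta>\<^sub>2 \<beta>\<^sub>3 \<beta>\<^sub>4
           + 2 * (x - t) * y * z * ((z - 1) * w + \<beta>\<^sub>2) / (t * (t - 1)))"
  defines "x \<equiv> v $ 1" and "y \<equiv> v $ 2" and "z \<equiv> v $ 3" and "w \<equiv> v $ 4"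
  shows "hamiltonian_field H t v $ 1 = 1 / (t * (t - 1)) *
      (2 * y * (x - t) * (x - 1) * x
       - ((\<alpha>\<^sub>0 - 1) * (x - 1) * x + \<alpha>\<^sub>3 * (x - t) * x + \<alpha>\<^sub>4 * (x - t) * (x - 1))
       + 2 * (x - t) * z * ((z - 1) * w + \<beta>\<^sub>2))" (is ?x)
    and "hamiltonian_field H t v $ 2 = - (1 / (t * (t - 1)) *
      (y^2 * ((x - 1) * x + (x - t) * x + (x - t) * (x - 1))
       - ((\<alpha>\<^sub>0 - 1) * (2 * x - 1) + \<alpha>\<^sub>3 * (2 * x - t) + \<alpha>\<^sub>4 * (2 * x - t - 1)) * y
       + \<alpha>\<^sub>2 * (\<alpha>\<^sub>1 + \<alpha>\<^sub>2) + 2 * y * z * ((z - 1) * w + \<beta>\<^sub>2)))" (is ?y)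
    and "hamiltonian_field H t v $ 3 = 1 / (t * (t - 1)) *
      (2 * w * (z - t) * (z - 1) * z
       - ((\<beta>\<^sub>0 - 1) * (z - 1) * z + \<beta>\<^sub>3 * (z - t) * z + \<beta>\<^sub>4 * (z - t) * (z - 1))
       + 2 * (x - t) * y * z * (z - 1))" (is ?z)
    and "hamiltonian_field H t v $ 4 = - (1 / (t * (t - 1)) *
      (w^2 * ((z - 1) * z + (z - t) * z + (z - t) * (z - 1))
       - ((\<beta>\<^sub>0 - 1) * (2 * z - 1) + \<beta>\<^sub>3 * (2 * z - t) + \<beta>\<^sub>4 * (2 * z - t - 1)) * w
       + \<beta>\<^sub>2 * (\<beta>\<^sub>1 + \<beta>\<^sub>2) + 2 * (x - t) * y * ((2 * z - 1) * w + \<beta>\<^sub>2)))" (is ?w)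
proof -
  define d where "d = 1 / (t * (t - 1))"
  have H: "H x y z w t = H_VI x y t \<alpha>\<^sub>0 \<alpha>\<^sub>1 \<alpha>\<^sub>2 \<alpha>\<^sub>3 \<alpha>\<^sub>4 + H_VI z w t \<beta>\<^sub>0 \<beta>\<^sub>1 \<beta>\<^sub>2 \<beta>\<^sub>3 \<beta>\<^sub>4
           + d * (2 * (x - t) * y * z * ((z - 1) * w + \<beta>\<^sub>2))" for x y z w
    by (simp add: H_def d_def)
  show ?x
    unfolding hamiltonian_field_def Let_def x_def[symmetric] y_def[symmetric]
      z_def[symmetric] w_def[symmetric] d_def[symmetric] H H_VI_def vector_4
    by (rule DERIV_imp_deriv)
      (auto intro!: derivative_eq_intros simp: algebra_simps power2_eq_square)
  show ?y
    unfolding hamiltonian_field_def Let_def x_def[symmetric] y_def[symmetric]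
      z_def[symmetric] w_def[symmetric] d_def[symmetric] H H_VI_def vector_4 neg_equal_iff_equal
    by (rule DERIV_imp_deriv)
      (auto intro!: derivative_eq_intros simp: algebra_simps power2_eq_square)
  show ?z
    unfolding hamiltonian_field_def Let_def x_def[symmetric] y_def[symmetric]
      z_def[symmetric] w_def[symmetric] d_def[symmetric] H H_VI_def vector_4
    by (rule DERIV_imp_deriv)
      (auto intro!: derivative_eq_intros simp: algebra_simps power2_eq_square)
  show ?w
    unfolding hamiltonian_field_def Let_def x_def[symmetric] y_def[symmetric]
      z_def[symmetric] w_def[symmetric] d_def[symmetric] H H_VI_def vector_4 neg_equal_iff_equal
    by (rule DERIV_imp_deriv)
      (auto intro!: derivative_eq_intros simp: algebra_simps power2_eq_square)
qed


section \<open>The six divisors visible in the coordinates x, y, z, w\<close>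

context
  fixes \<alpha>\<^sub>0 \<alpha>\<^sub>1 \<alpha>\<^sub>2 \<alpha>\<^sub>3 \<alpha>\<^sub>4 \<beta>\<^sub>0 \<beta>\<^sub>1 \<beta>\<^sub>2 \<beta>\<^sub>3 \<beta>\<^sub>4 :: complex
    and H :: "complex \<Rightarrow> complex \<Rightarrow> complex \<Rightarrow> complex \<Rightarrow> complex \<Rightarrow> complex"
  defines "H \<equiv> (\<lambda>x y z w t.
           H_VI x y t \<alpha>\<^sub>0 \<alpha>\<^sub>1 \<alpha>\<^sub>2 \<alpha>\<^sub>3 \<alpha>\<^sub>4 + H_VI z w t \<beta>\<^sub>0 \<beta>\<^sub>1 \<beta>\<^sub>2 \<beta>\<^sub>3 \<beta>\<^sub>4
           + 2 * (x - t) * y * z * ((z - 1) * w + \<beta>\<^sub>2) / (t * (t - 1)))"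
begin

lemmas field_eqs = coupled_field_components[of \<alpha>\<^sub>0 \<alpha>\<^sub>1 \<alpha>\<^sub>2 \<alpha>\<^sub>3 \<alpha>\<^sub>4 \<beta>\<^sub>0 \<beta>\<^sub>1 \<beta>\<^sub>2 \<beta>\<^sub>3 \<beta>\<^sub>4,
  folded H_def]

lemma holo_poly_coupled_field: "holo_poly (- {0, 1}) (\<lambda>t v. hamiltonian_field H t v $ i)"
proof -
  have "\<forall>i. holo_poly (- {0, 1}) (\<lambda>t v. hamiltonian_field H t v $ i)"
    unfolding forall_4 field_eqs
    by (intro conjI holo_poly_intros holo_poly_time_factor)
  then show ?thesis by blast
qed

text \<open>For \<open>\<alpha>\<^sub>0 = 0\<close> the only term of \<open>t (t - 1) x'\<close>
  without the factor \<open>x - t\<close> is \<open>(x - 1) x\<close>. Subtracting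
  \<open>t (t - 1)\<close>, which accounts for the derivative of \<open>t\<close>, leaves
  \<open>(x - t) (x + t - 1)\<close>.\<close>

lemma invariant_x_eq_t:
  assumes "\<alpha>\<^sub>0 = 0"
  shows "invariant_divisor (hamiltonian_field H) (\<lambda>t v. v $ 1 - t)"
proof (rule invariant_divisor_if_cofactor[OF holo_poly_coupled_field])
  let ?g = "\<lambda>t v. 1 / (t * (t - 1)) * (2 * v $ 2 * (v $ 1 - 1) * v $ 1 + v $ 1 + t - 1
    - \<alpha>\<^sub>3 * v $ 1 - \<alpha>\<^sub>4 * (v $ 1 - 1) + 2 * v $ 3 * ((v $ 3 - 1) * v $ 4 + \<beta>\<^sub>2))"
  show "holo_poly (- {0, 1}) ?g"
    by (intro holo_poly_intros holo_poly_time_factor)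
  fix U u t
  assume *: "solution_on (hamiltonian_field H) U u" "t \<in> U" "t \<notin> {0, 1}"
  define d where "d = 1 / (t * (t - 1))"
  have d: "d * (t * (t - 1)) = 1"
    using *(3) by (simp add: d_def)
  \<comment> \<open>The number 1 is written as \<open>d * (t * (t - 1))\<close>, so that the
    identity is polynomial with \<open>d\<close> as an independent variable.\<close>
  have "hamiltonian_field H t v $ 1 - d * (t * (t - 1)) = (v $ 1 - t) * ?g t v" for v
    unfolding field_eqs assms d_def[symmetric] by algebra
  then show "((\<lambda>s. u s $ 1 - s) has_field_derivative (u t $ 1 - t) * ?g t (u t)) (at t)"
    unfolding d using solution_on_component[OF *(1,2)] by (auto intro!: derivative_eq_intros)
qed

text \<open>The only term of \<open>y'\<close> free of \<open>y\<close> is a multiple of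
  \<open>\<alpha>\<^sub>2\<close>.\<close>

lemma invariant_y_eq_0:
  assumes "\<alpha>\<^sub>2 = 0"
  shows "invariant_divisor (hamiltonian_field H) (\<lambda>t v. v $ 2)"
proof (rule invariant_divisor_if_cofactor[OF holo_poly_coupled_field])
  let ?g = "\<lambda>t v. - (1 / (t * (t - 1))) *
    (v $ 2 * ((v $ 1 - 1) * v $ 1 + (v $ 1 - t) * v $ 1 + (v $ 1 - t) * (v $ 1 - 1))
     - ((\<alpha>\<^sub>0 - 1) * (2 * v $ 1 - 1) + \<alpha>\<^sub>3 * (2 * v $ 1 - t) + \<alpha>\<^sub>4 * (2 * v $ 1 - t - 1))
     + 2 * v $ 3 * ((v $ 3 - 1) * v $ 4 + \<beta>\<^sub>2))"
  show "holo_poly (- {0, 1}) ?g"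
    by (intro holo_poly_intros holo_poly_time_factor)
  fix U u t
  assume *: "solution_on (hamiltonian_field H) U u" "t \<in> U" "t \<notin> {0, 1}"
  define d where "d = 1 / (t * (t - 1))"
  have "hamiltonian_field H t v $ 2 = v $ 2 * ?g t v" for v
    unfolding field_eqs assms d_def[symmetric] by algebra
  then show "((\<lambda>s. u s $ 2) has_field_derivative u t $ 2 * ?g t (u t)) (at t)"
    using solution_on_component[OF *(1,2)] by metis
qed

text \<open>The parameters reduce to
  \<open>\<alpha>\<^sub>3 = 2 * \<beta>\<^sub>2 + \<beta>\<^sub>3\<close>,
  \<open>\<beta>\<^sub>0 = \<alpha>\<^sub>0\<close> and
  \<open>\<beta>\<^sub>4 = \<alpha>\<^sub>4\<close>. Then in \<open>x' - z'\<close> the coefficients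
  of \<open>y\<close>, of \<open>w\<close> and of each parameter are separately divisible by
  \<open>x - z\<close>; for \<open>\<beta>\<^sub>2\<close> the share of
  \<open>\<alpha>\<^sub>3\<close> combines with the coupling term.\<close>

lemma invariant_x_eq_z:
  assumes "\<alpha>\<^sub>4 = \<beta>\<^sub>4" "\<alpha>\<^sub>3 = \<alpha>\<^sub>4 - \<beta>\<^sub>4 + 2 * \<beta>\<^sub>2 + \<beta>\<^sub>3" "\<beta>\<^sub>0 = \<alpha>\<^sub>0 + \<alpha>\<^sub>4 - \<beta>\<^sub>4"
  shows "invariant_divisor (hamiltonian_field H) (\<lambda>t v. v $ 1 - v $ 3)"
proof (rule invariant_divisor_if_cofactor[OF holo_poly_coupled_field])
  let ?g = "\<lambda>t v. 1 / (t * (t - 1)) * (2 * v $ 2 * (v $ 1 - t) * (v $ 1 + v $ 3 - 1)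
    + 2 * v $ 4 * v $ 3 * (v $ 3 - 1) - (\<alpha>\<^sub>0 - 1) * (v $ 1 + v $ 3 - 1)
    - \<alpha>\<^sub>4 * (v $ 1 + v $ 3 - 1 - t) - \<beta>\<^sub>3 * (v $ 1 + v $ 3 - t) - 2 * \<beta>\<^sub>2 * (v $ 1 - t))"
  show "holo_poly (- {0, 1}) ?g"
    by (intro holo_poly_intros holo_poly_time_factor)
  fix U u t
  assume *: "solution_on (hamiltonian_field H) U u" "t \<in> U" "t \<notin> {0, 1}"
  define d where "d = 1 / (t * (t - 1))"
  have "\<alpha>\<^sub>3 = 2 * \<beta>\<^sub>2 + \<beta>\<^sub>3" "\<beta>\<^sub>0 = \<alpha>\<^sub>0" "\<beta>\<^sub>4 = \<alpha>\<^sub>4"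
    using assms by auto
  note params = this
  have "hamiltonian_field H t v $ 1 - hamiltonian_field H t v $ 3 = (v $ 1 - v $ 3) * ?g t v" for v
    unfolding field_eqs params d_def[symmetric] by algebra
  then show "((\<lambda>s. u s $ 1 - u s $ 3) has_field_derivative
      (u t $ 1 - u t $ 3) * ?g t (u t)) (at t)"
    using DERIV_diff[OF solution_on_component[OF *(1,2)] solution_on_component[OF *(1,2)]] by metis
qed

text \<open>The terms of \<open>w'\<close> free of \<open>w\<close>, one of them from the coupling,
  are multiples of \<open>\<beta>\<^sub>2\<close>.\<close>

lemma invariant_w_eq_0:
  assumes "\<beta>\<^sub>2 = 0"
  shows "invariant_divisor (hamiltonian_field H) (\<lambda>t v. v $ 4)"
proof (rule invariant_divisor_if_cofactor[OF holo_poly_coupled_field])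
  let ?g = "\<lambda>t v. - (1 / (t * (t - 1))) *
    (v $ 4 * ((v $ 3 - 1) * v $ 3 + (v $ 3 - t) * v $ 3 + (v $ 3 - t) * (v $ 3 - 1))
     - ((\<beta>\<^sub>0 - 1) * (2 * v $ 3 - 1) + \<beta>\<^sub>3 * (2 * v $ 3 - t) + \<beta>\<^sub>4 * (2 * v $ 3 - t - 1))
     + 2 * (v $ 1 - t) * v $ 2 * (2 * v $ 3 - 1))"
  show "holo_poly (- {0, 1}) ?g"
    by (intro holo_poly_intros holo_poly_time_factor)
  fix U u t
  assume *: "solution_on (hamiltonian_field H) U u" "t \<in> U" "t \<notin> {0, 1}"
  define d where "d = 1 / (t * (t - 1))"
  have "hamiltonian_field H t v $ 4 = v $ 4 * ?g t v" for v
    unfolding field_eqs assms d_def[symmetric] by algebra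
  then show "((\<lambda>s. u s $ 4) has_field_derivative u t $ 4 * ?g t (u t)) (at t)"
    using solution_on_component[OF *(1,2)] by metis
qed

text \<open>In \<open>z'\<close> only the term with \<open>\<beta>\<^sub>3\<close> lacks the factor
  \<open>z - 1\<close>.\<close>

lemma invariant_z_eq_1:
  assumes "\<beta>\<^sub>3 = 0"
  shows "invariant_divisor (hamiltonian_field H) (\<lambda>t v. v $ 3 - 1)"
proof (rule invariant_divisor_if_cofactor[OF holo_poly_coupled_field])
  let ?g = "\<lambda>t v. 1 / (t * (t - 1)) * (2 * v $ 4 * (v $ 3 - t) * v $ 3
    - (\<beta>\<^sub>0 - 1) * v $ 3 - \<beta>\<^sub>4 * (v $ 3 - t) + 2 * (v $ 1 - t) * v $ 2 * v $ 3)"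
  show "holo_poly (- {0, 1}) ?g"
    by (intro holo_poly_intros holo_poly_time_factor)
  fix U u t
  assume *: "solution_on (hamiltonian_field H) U u" "t \<in> U" "t \<notin> {0, 1}"
  define d where "d = 1 / (t * (t - 1))"
  \<comment> \<open>The 0 is the derivative of the constant 1, kept to match the difference
    rule.\<close>
  have "hamiltonian_field H t v $ 3 - 0 = (v $ 3 - 1) * ?g t v" for v
    unfolding field_eqs assms d_def[symmetric] by algebra
  then show "((\<lambda>s. u s $ 3 - 1) has_field_derivative (u t $ 3 - 1) * ?g t (u t)) (at t)"
    using DERIV_diff[OF solution_on_component[OF *(1,2)] DERIV_const] by metis
qed

text \<open>In \<open>z'\<close> only the term with \<open>\<beta>\<^sub>4\<close> lacks the factor
  \<open>z\<close>.\<close>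

lemma invariant_z_eq_0:
  assumes "\<beta>\<^sub>4 = 0"
  shows "invariant_divisor (hamiltonian_field H) (\<lambda>t v. v $ 3)"
proof (rule invariant_divisor_if_cofactor[OF holo_poly_coupled_field])
  let ?g = "\<lambda>t v. 1 / (t * (t - 1)) * (2 * v $ 4 * (v $ 3 - t) * (v $ 3 - 1)
    - (\<beta>\<^sub>0 - 1) * (v $ 3 - 1) - \<beta>\<^sub>3 * (v $ 3 - t) + 2 * (v $ 1 - t) * v $ 2 * (v $ 3 - 1))"
  show "holo_poly (- {0, 1}) ?g"
    by (intro holo_poly_intros holo_poly_time_factor)
  fix U u t
  assume *: "solution_on (hamiltonian_field H) U u" "t \<in> U" "t \<notin> {0, 1}"
  define d where "d = 1 / (t * (t - 1))"
  have "hamiltonian_field H t v $ 3 = v $ 3 * ?g t v" for v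
    unfolding field_eqs assms d_def[symmetric] by algebra
  then show "((\<lambda>s. u s $ 3) has_field_derivative u t $ 3 * ?g t (u t)) (at t)"
    using solution_on_component[OF *(1,2)] by metis
qed

section \<open>The divisor at infinity\<close>

lemma invariant_x_eq_infinity:
  assumes "\<alpha>\<^sub>0 + \<alpha>\<^sub>1 + 2 * \<alpha>\<^sub>2 + \<alpha>\<^sub>3 + \<alpha>\<^sub>4 = 1" "\<alpha>\<^sub>1 = 0"
  shows "invariant_divisor_x_infinity \<alpha>\<^sub>2 (hamiltonian_field H)"
proof -
  \<comment> \<open>The coordinate change is symplectic and does not involve \<open>t\<close>, so \<open>V'\<close> is the Hamiltonian field
    of \<open>H\<close> written in the new coordinates \<open>X, Y, Z, W\<close>. There \<open>y = - X a\<close> with \<open>a = X Y + \<alpha>\<^sub>2\<close>, and the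
    poles at \<open>X = 0\<close> cancel because of the relation between the parameters: \<open>t (t - 1) H\<close> becomes
    \<open>X Y\<^sup>2 - e a\<^sup>2 - c a - 2 (1 - t X) a Z b\<close> plus the part in \<open>Z, W\<close> of the second \<open>H_VI\<close>.\<close>
  define a where "a v = v $ 1 * v $ 2 + \<alpha>\<^sub>2" for v :: "complex^4"
  define e where "e t v = 1 + t - t * v $ 1" for t and v :: "complex^4"
  define c where "c t v = \<alpha>\<^sub>0 - 1 + \<alpha>\<^sub>3 * t + \<alpha>\<^sub>4 * e t v" for t v
  define b where "b v = (v $ 3 - 1) * v $ 4 + \<beta>\<^sub>2" for v :: "complex^4"
  \<comment> \<open>This is the cofactor of \<open>X\<close>: the variable \<open>Y\<close> enters
    the transformed Hamiltonian only through \<open>X Y^2\<close> and \<open>a\<close>, whose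
    derivatives in \<open>Y\<close> are divisible by \<open>X\<close>.\<close>
  define g where "g t v = 1 / (t * (t - 1)) *
    (2 * v $ 2 - 2 * e t v * a v - c t v - 2 * (1 - t * v $ 1) * v $ 3 * b v)" for t v
  define V' :: "complex \<Rightarrow> complex^4 \<Rightarrow> complex^4" where "V' t v = vector
    [v $ 1 * g t v,
     - (1 / (t * (t - 1)) *
       ((v $ 2)^2 + t * (a v)^2 - 2 * e t v * a v * v $ 2 + t * \<alpha>\<^sub>4 * a v - c t v * v $ 2
        + 2 * t * a v * v $ 3 * b v - 2 * (1 - t * v $ 1) * v $ 2 * v $ 3 * b v)),
     1 / (t * (t - 1)) *
       (2 * v $ 4 * (v $ 3 - t) * (v $ 3 - 1) * v $ 3
       - ((\<beta>\<^sub>0 - 1) * (v $ 3 - 1) * v $ 3 + \<beta>\<^sub>3 * (v $ 3 - t) * v $ 3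
          + \<beta>\<^sub>4 * (v $ 3 - t) * (v $ 3 - 1))
       - 2 * (1 - t * v $ 1) * a v * v $ 3 * (v $ 3 - 1)),
     - (1 / (t * (t - 1)) *
       ((v $ 4)^2 * ((v $ 3 - 1) * v $ 3 + (v $ 3 - t) * v $ 3 + (v $ 3 - t) * (v $ 3 - 1))
       - ((\<beta>\<^sub>0 - 1) * (2 * v $ 3 - 1) + \<beta>\<^sub>3 * (2 * v $ 3 - t) + \<beta>\<^sub>4 * (2 * v $ 3 - t - 1)) * v $ 4
       + \<beta>\<^sub>2 * (\<beta>\<^sub>1 + \<beta>\<^sub>2) - 2 * (1 - t * v $ 1) * a v * ((2 * v $ 3 - 1) * v $ 4 + \<beta>\<^sub>2)))]"
    for t v
  have "\<forall>i. holo_poly (- {0, 1}) (\<lambda>t v. V' t v $ i)"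
    unfolding forall_4 V'_def vector_4 g_def a_def b_def c_def e_def
    by (intro conjI holo_poly_intros holo_poly_time_factor)
  then have poly: "holo_poly (- {0, 1}) (\<lambda>t v. V' t v $ i)" for i
    by blast
  have "invariant_divisor V' (\<lambda>t v. v $ 1)"
  proof (rule invariant_divisor_if_cofactor[OF poly])
    show "holo_poly (- {0, 1}) g"
      unfolding g_def a_def b_def c_def e_def
      by (intro holo_poly_intros holo_poly_time_factor)
    show "((\<lambda>s. u s $ 1) has_field_derivative u t $ 1 * g t (u t)) (at t)"
      if "solution_on V' U u" "t \<in> U" for U u t
      using solution_on_component[OF that, of 1] by (simp add: V'_def)
  qed
  moreover have "field_in_coordinates (coords_at_infinity \<alpha>\<^sub>2) {v. v $ 1 \<noteq> 0} (hamiltonian_field H) V'"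
    unfolding field_in_coordinates_def
  proof (intro conjI ballI)
    have "continuous_on ((- {0, 1}) \<times> UNIV) (\<lambda>p. \<chi> i. (\<lambda>(t, v). V' t v $ i) p)"
      by (intro continuous_on_vec_lambda holo_poly_continuous poly)
    then show "continuous_on ((- {0, 1}) \<times> UNIV) (\<lambda>(t, v). V' t v)"
      by (simp add: case_prod_beta)
    fix t :: complex and v :: "complex^4"
    assume "v \<in> {v. v $ 1 \<noteq> 0}"
    then have x: "v $ 1 \<noteq> 0" by simp
    let ?\<phi> = "coords_at_infinity \<alpha>\<^sub>2"
    \<comment> \<open>The differential of the coordinate change, read off from
      \<open>X = 1 / x\<close> and \<open>Y = - x^2 y - \<alpha>\<^sub>2 x\<close>.\<close>
    define D :: "complex^4 \<Rightarrow> complex^4" where "D h = vector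
      [- (h $ 1) / (v $ 1)^2, - (2 * v $ 1 * v $ 2 + \<alpha>\<^sub>2) * h $ 1 - (v $ 1)^2 * h $ 2, h $ 3, h $ 4]" for h
    have nth: "((\<lambda>v. v $ i) has_derivative (\<lambda>h. h $ i)) (at v)" for i :: 4
      by (rule bounded_linear_imp_has_derivative[OF bounded_linear_vec_nth])
    have "\<forall>i. ((\<lambda>v. ?\<phi> v $ i) has_derivative (\<lambda>h. D h $ i)) (at v)"
      unfolding forall_4 coords_at_infinity_def Let_def D_def vector_4
      using x by (auto intro!: derivative_eq_intros nth
        simp: fun_eq_iff field_simps power2_eq_square)
    then have "(?\<phi> has_derivative D) (at v)"
      by (intro has_derivative_vecI) blast
    then have "?\<phi> differentiable (at v)" and D: "frechet_derivative ?\<phi> (at v) = D"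
      using frechet_derivative_at differentiable_def by metis+
    show "?\<phi> differentiable (at v)" by fact
    define d where "d = 1 / (t * (t - 1))"
    \<comment> \<open>Division by \<open>x\<close> is replaced by the polynomial relation
      \<open>X * x = 1\<close>, from which the component identities follow algebraically.\<close>
    define X where "X = 1 / v $ 1"
    have X: "X * v $ 1 = 1"
      using x by (simp add: X_def)
    have \<phi>: "?\<phi> v = vector [X, - v $ 1 * (v $ 1 * v $ 2 + \<alpha>\<^sub>2), v $ 3, v $ 4]"
      by (simp add: coords_at_infinity_def Let_def X_def)
    have D': "D h = vector [- (h $ 1) * X^2,
        - (2 * v $ 1 * v $ 2 + \<alpha>\<^sub>2) * h $ 1 - (v $ 1)^2 * h $ 2, h $ 3, h $ 4]" for h
      by (simp add: D_def X_def power_divide)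
    \<comment> \<open>This makes the poles cancel: with \<open>\<alpha>\<^sub>1 = 0\<close> the
      terms of order \<open>1 / X\<close> in \<open>t (t - 1) H\<close> add up to
      \<open>(a - \<alpha>\<^sub>2)^2 / X\<close>, which equals \<open>X Y^2\<close>.\<close>
    have \<alpha>\<^sub>0: "\<alpha>\<^sub>0 = 1 - 2 * \<alpha>\<^sub>2 - \<alpha>\<^sub>3 - \<alpha>\<^sub>4"
      using assms by (simp add: algebra_simps)
    have "V' t (?\<phi> v) $ 1 = D (hamiltonian_field H t v) $ 1"
      unfolding V'_def g_def a_def b_def c_def e_def \<phi> D' vector_4 field_eqs \<alpha>\<^sub>0 assms(2)
        d_def[symmetric] using X by algebra
    moreover have "V' t (?\<phi> v) $ 2 = D (hamiltonian_field H t v) $ 2"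
      unfolding V'_def g_def a_def b_def c_def e_def \<phi> D' vector_4 field_eqs \<alpha>\<^sub>0 assms(2)
        d_def[symmetric] using X by algebra
    moreover have "V' t (?\<phi> v) $ 3 = D (hamiltonian_field H t v) $ 3"
      unfolding V'_def g_def a_def b_def c_def e_def \<phi> D' vector_4 field_eqs
        d_def[symmetric] using X by algebra
    moreover have "V' t (?\<phi> v) $ 4 = D (hamiltonian_field H t v) $ 4"
      unfolding V'_def g_def a_def b_def c_def e_def \<phi> D' vector_4 field_eqs
        d_def[symmetric] using X by algebra
    ultimately show "V' t (?\<phi> v) = frechet_derivative ?\<phi> (at v) (hamiltonian_field H t v)"
      unfolding D vec_eq_iff forall_4 by blast
  qed
  ultimately show ?thesis
    unfolding invariant_divisor_x_infinity_def by blast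
qed

end

theorem proposition2p4:
  fixes \<alpha>\<^sub>0 \<alpha>\<^sub>1 \<alpha>\<^sub>2 \<alpha>\<^sub>3 \<alpha>\<^sub>4 \<beta>\<^sub>0 \<beta>\<^sub>1 \<beta>\<^sub>2 \<beta>\<^sub>3 \<beta>\<^sub>4 :: complex
    and H :: "complex \<Rightarrow> complex \<Rightarrow> complex \<Rightarrow> complex \<Rightarrow> complex \<Rightarrow> complex"
    and S :: "complex \<Rightarrow> complex^4 \<Rightarrow> complex^4"
  assumes "\<alpha>\<^sub>0 + \<alpha>\<^sub>1 + 2 * \<alpha>\<^sub>2 + 2 * (\<alpha>\<^sub>4 - \<beta>\<^sub>4) + 2 * \<beta>\<^sub>2 + \<beta>\<^sub>3 + \<beta>\<^sub>4 = 1"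
    and "\<alpha>\<^sub>3 = \<alpha>\<^sub>4 - \<beta>\<^sub>4 + 2 * \<beta>\<^sub>2 + \<beta>\<^sub>3"
    and "\<beta>\<^sub>0 = \<alpha>\<^sub>0 + \<alpha>\<^sub>4 - \<beta>\<^sub>4"
    and "\<beta>\<^sub>1 = \<alpha>\<^sub>1 + 2 * \<alpha>\<^sub>2 + \<alpha>\<^sub>4 - \<beta>\<^sub>4"
    and "H = (\<lambda>x y z w t.
           H_VI x y t \<alpha>\<^sub>0 \<alpha>\<^sub>1 \<alpha>\<^sub>2 \<alpha>\<^sub>3 \<alpha>\<^sub>4 + H_VI z w t \<beta>\<^sub>0 \<beta>\<^sub>1 \<beta>\<^sub>2 \<beta>\<^sub>3 \<beta>\<^sub>4
           + 2 * (x - t) * y * z * ((z - 1) * w + \<beta>\<^sub>2) / (t * (t - 1)))"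
    and "S = hamiltonian_field H"
  shows "(\<alpha>\<^sub>0 = 0 \<longrightarrow> invariant_divisor S (\<lambda>t v. v $ 1 - t)) \<and>
         (\<alpha>\<^sub>1 = 0 \<longrightarrow> invariant_divisor_x_infinity \<alpha>\<^sub>2 S) \<and>
         (\<alpha>\<^sub>2 = 0 \<longrightarrow> invariant_divisor S (\<lambda>t v. v $ 2)) \<and>
         (\<alpha>\<^sub>4 = \<beta>\<^sub>4 \<longrightarrow> invariant_divisor S (\<lambda>t v. v $ 1 - v $ 3)) \<and>
         (\<beta>\<^sub>2 = 0 \<longrightarrow> invariant_divisor S (\<lambda>t v. v $ 4)) \<and>
         (\<beta>\<^sub>3 = 0 \<longrightarrow> invariant_divisor S (\<lambda>t v. v $ 3 - 1)) \<and>
         (\<beta>\<^sub>4 = 0 \<longrightarrow> invariant_divisor S (\<lambda>t v. v $ 3))"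
proof -
  \<comment> \<open>Inserting the formula for \<open>\<alpha>\<^sub>3\<close> turns the relation
    between the free parameters into the normalisation of the first \<open>H_VI\<close>, which the
    divisor at infinity requires.\<close>
  have "\<alpha>\<^sub>0 + \<alpha>\<^sub>1 + 2 * \<alpha>\<^sub>2 + \<alpha>\<^sub>3 + \<alpha>\<^sub>4 = 1"
    using assms(1) unfolding assms(2) by (simp add: algebra_simps)
  then show ?thesis
    unfolding assms(5,6)
    by (intro conjI impI)
      (erule invariant_x_eq_t invariant_x_eq_infinity invariant_y_eq_0
         invariant_x_eq_z[OF _ assms(2,3)] invariant_w_eq_0 invariant_z_eq_1 invariant_z_eq_0
       | assumption)+
qed

end
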